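(* Let $X$ be a normed space, let $F\subseteq X$ be a nonempty closed convex set, and let $Q\subseteq X$ be nonempty. Suppose that one of the following holds: (i) $X$ is a reflexive Banach space, $Q$ is a bounded weakly closed set, and $0\in F$; (ii) $Q$ is a compact set and $0\in F$. Then, for $x\in X$, $\mathcal{T}^F_Q(x)=0$ if and only if $x\in Q-F_\infty$.
   Context: Normed spaces are real. For $t\ge 0$, $tF=\{tf: f\in F\}$ (so $0F=\{0\}$), and $\inf\emptyset=\infty$. The minimal time function is $\mathcal{T}^F_Q(x)=\inf\{t\ge 0: (x+tF)\cap Q\ne\emptyset\}\in[0,\infty]$. The asymptotic cone of $F$ is $F_\infty=\{d\in X: x+td\in F \text{ for all } t>0\}$, where $x\in F$ is any point (the set does not depend on the choice of $x\in F$). $Q-F_\infty=\{q-d: q\in Q,\ d\in F_\infty\}$. *)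

theory Defs
  imports "HOL-Analysis.Analysis"
begin

definition bidual_embedding :: "'a::real_normed_vector \<Rightarrow> (('a \<Rightarrow>\<^sub>L real) \<Rightarrow>\<^sub>L real)" where
  "bidual_embedding x = Blinfun (\<lambda>f. blinfun_apply f x)"

text \<open>The argument of \<^const>\<open>Blinfun\<close> above is bounded and linear, so evaluation is as expected.\<close>

lemma bidual_embedding_apply [simp]:
  "blinfun_apply (bidual_embedding x) f = blinfun_apply f x"
  unfolding bidual_embedding_def
  by (simp add: bounded_linear_Blinfun_apply blinfun.bounded_linear_left)

definition reflexive_Banach :: "'a::real_normed_vector itself \<Rightarrow> bool" where
  "reflexive_Banach _ \<longleftrightarrow>
     complete (UNIV :: 'a set) \<and>
     surj (bidual_embedding :: 'a \<Rightarrow> (('a \<Rightarrow>\<^sub>L real) \<Rightarrow>\<^sub>L real))"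

definition weak_topology :: "'a::real_normed_vector topology" where
  "weak_topology =
     topology_generated_by {blinfun_apply f -` U | (f :: 'a \<Rightarrow>\<^sub>L real) U. open U}"

text \<open>In \<^typ>\<open>ennreal\<close> the infimum of the empty set is \<open>\<infinity>\<close>.\<close>

definition minimal_time ::
  "'a::real_normed_vector set \<Rightarrow> 'a set \<Rightarrow> 'a \<Rightarrow> ennreal" where
  "minimal_time F Q x =
     Inf {ennreal t | t. 0 \<le> t \<and> (+) x ` ((*\<^sub>R) t ` F) \<inter> Q \<noteq> {}}"

text \<open>For closed convex \<open>F\<close> the base point is immaterial, as the lemma after the definition shows.\<close>

definition asymptotic_cone :: "'a::real_normed_vector set \<Rightarrow> 'a set" where
  "asymptotic_cone F = {d. \<exists>a\<in>F. \<forall>t>0. a + t *\<^sub>R d \<in> F}"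

lemma asymptotic_cone_eq:
  fixes F :: "'a::real_normed_vector set"
  assumes "closed F" and "convex F" and "a \<in> F"
  shows "asymptotic_cone F = {d. \<forall>t>0. a + t *\<^sub>R d \<in> F}"
proof -
  have "a + t *\<^sub>R d \<in> F"
    if b: "b \<in> F" "\<And>s. 0 < s \<Longrightarrow> b + s *\<^sub>R d \<in> F" and t: "0 < t" for b d t
  proof -
    define y where "y n = a + t *\<^sub>R d + inverse (real (Suc n)) *\<^sub>R (b - a)" for n
    have "y n \<in> F" for n
    proof -
      define u where "u = inverse (real (Suc n))"
      have u: "0 < u" "u \<le> 1" by (simp_all add: u_def field_simps)
      have "(1 - u) *\<^sub>R a + u *\<^sub>R (b + (t / u) *\<^sub>R d) \<in> F"
        using assms b(2)[of "t / u"] t u by (intro convexD) auto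
      also have "(1 - u) *\<^sub>R a + u *\<^sub>R (b + (t / u) *\<^sub>R d) = y n"
        using u(1) unfolding y_def u_def[symmetric] by (simp add: algebra_simps)
      finally show ?thesis .
    qed
    moreover have "y \<longlonglongrightarrow> a + t *\<^sub>R d + 0 *\<^sub>R (b - a)"
      unfolding y_def by (intro tendsto_intros LIMSEQ_inverse_real_of_nat)
    ultimately show ?thesis
      using closed_sequentially[OF \<open>closed F\<close>, of y] by simp
  qed
  with \<open>a \<in> F\<close> show ?thesis
    unfolding asymptotic_cone_def by blast
qed

end

theory Submission
  imports Defs
begin

text \<open>Since \<open>0 \<in> F\<close>, the sets \<open>x + tF\<close> shrink as \<open>t\<close> decreases to \<open>0\<close>; the minimal time vanishes iff each
  of them meets \<open>Q\<close>, whereas \<open>x \<in> Q - F\<^sub>\<infinity>\<close> says that they have a common point in \<open>Q\<close>. These are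
  equivalent by the finite intersection property, applied to the norm topology in case (ii) and to
  the weak topology in case (i): closed convex sets are weakly closed by Hahn--Banach separation, and
  bounded weakly closed sets in a reflexive space are weakly compact. Hahn--Banach itself is obtained
  from the fact that a minimal sublinear functional is linear.\<close>

section \<open>Sublinear functionals and their infima\<close>

text \<open>Homogeneity is asked only as an inequality for positive factors, which is the part to be
  checked for infima. Applying it to \<open>inverse c\<close> gives equality, and the factor
  \<open>1/2\<close> together with subadditivity gives \<open>p 0 = 0\<close>.\<close>

definition sublinear :: "('a::real_vector \<Rightarrow> real) \<Rightarrow> bool" where
  "sublinear p \<longleftrightarrow>
     (\<forall>x y. p (x + y) \<le> p x + p y) \<and> (\<forall>c x. 0 < c \<longrightarrow> p (c *\<^sub>R x) \<le> c * p x)"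

lemma sublinearI:
  assumes "\<And>x y. p (x + y) \<le> p x + p y"
    and "\<And>c x. 0 < c \<Longrightarrow> p (c *\<^sub>R x) \<le> c * p x"
  shows "sublinear p"
  using assms by (simp add: sublinear_def)

lemma sublinear_add: "sublinear p \<Longrightarrow> p (x + y) \<le> p x + p y"
  by (simp add: sublinear_def)

lemma sublinear_scaleR_le: "sublinear p \<Longrightarrow> 0 < c \<Longrightarrow> p (c *\<^sub>R x) \<le> c * p x"
  by (simp add: sublinear_def)

lemma sublinear_0:
  assumes "sublinear p"
  shows "p 0 = 0"
  using sublinear_add[OF assms, of 0 0] sublinear_scaleR_le[OF assms, of "1/2" 0] by simp

lemma sublinear_scaleR:
  assumes "sublinear p" "0 \<le> c"
  shows "p (c *\<^sub>R x) = c * p x"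
proof (cases "c = 0")
  case True
  then show ?thesis by (simp add: sublinear_0[OF assms(1)])
next
  case False
  with assms have c: "0 < c" by simp
  have "p (inverse c *\<^sub>R c *\<^sub>R x) \<le> inverse c * p (c *\<^sub>R x)"
    using c by (intro sublinear_scaleR_le assms) simp
  then have "c * p x \<le> p (c *\<^sub>R x)"
    using c by (simp add: field_simps)
  then show ?thesis
    using sublinear_scaleR_le[OF assms(1) c, of x] by simp
qed

lemma sublinear_ge_minus:
  assumes "sublinear p"
  shows "- p (- x) \<le> p x"
  using sublinear_add[OF assms, of x "- x"] sublinear_0[OF assms] by simp

text \<open>The bound is uniform in \<open>q\<close>, which keeps pointwise infima of sublinear
  functionals below \<open>p\<close> finite.\<close>

lemma sublinear_lower_bound:
  assumes "sublinear p" "q \<le> p" "sublinear q"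
  shows "- p (- x) \<le> q x"
  using sublinear_ge_minus[OF assms(3), of x] le_funD[OF assms(2), of "- x"] by simp

text \<open>Supplies the lower bounds of chains for Zorn's lemma. Subadditivity rests on
  comparability: the smaller one of \<open>q\<close> and \<open>r\<close>, evaluated at
  \<open>x + y\<close>, is at most \<open>q x + r y\<close>, and the infima over \<open>q\<close>
  and \<open>r\<close> are then taken one after the other.\<close>

lemma sublinear_chain_INF:
  assumes "C \<noteq> {}" and "\<And>q. q \<in> C \<Longrightarrow> sublinear q \<and> q \<le> p" and "sublinear p"
    and "\<And>q r. q \<in> C \<Longrightarrow> r \<in> C \<Longrightarrow> q \<le> r \<or> r \<le> q"
  shows "sublinear (\<lambda>x. INF q\<in>C. q x)" and "\<And>q. q \<in> C \<Longrightarrow> (\<lambda>x. INF q\<in>C. q x) \<le> q"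
proof -
  have bdd: "bdd_below ((\<lambda>q. q x) ` C)" for x
    using assms by (intro bdd_belowI2[where m = "- p (- x)"] sublinear_lower_bound) auto
  have le: "(INF q\<in>C. q x) \<le> q x" if "q \<in> C" for q x
    using that by (intro cINF_lower bdd)
  show "sublinear (\<lambda>x. INF q\<in>C. q x)"
  proof (rule sublinearI)
    fix x y
    have *: "(INF q\<in>C. q (x + y)) \<le> q x + r y" if qr: "q \<in> C" "r \<in> C" for q r
    proof -
      obtain s where s: "s \<in> C" "s \<le> q" "s \<le> r"
        using assms(4)[OF qr] qr by (meson order_refl)
      have "(INF q\<in>C. q (x + y)) \<le> s (x + y)" by (rule le) fact
      also have "\<dots> \<le> s x + s y" using s assms(2) by (intro sublinear_add) auto
      also have "\<dots> \<le> q x + r y" using s by (simp add: add_mono le_funD)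
      finally show ?thesis .
    qed
    have "(INF q\<in>C. q (x + y)) - r y \<le> (INF q\<in>C. q x)" if "r \<in> C" for r
      using *[OF _ that] by (intro cINF_greatest assms) (simp add: diff_le_eq)
    then have "(INF q\<in>C. q (x + y)) - (INF q\<in>C. q x) \<le> (INF q\<in>C. q y)"
      by (intro cINF_greatest assms) (auto simp: algebra_simps)
    then show "(INF q\<in>C. q (x + y)) \<le> (INF q\<in>C. q x) + (INF q\<in>C. q y)" by simp
  next
    fix c :: real and x assume c: "0 < c"
    have "inverse c * (INF q\<in>C. q (c *\<^sub>R x)) \<le> q x" if "q \<in> C" for q
    proof -
      have "(INF q\<in>C. q (c *\<^sub>R x)) \<le> c * q x"
        using le[OF that, of "c *\<^sub>R x"] sublinear_scaleR[of q c x] assms(2)[OF that] c by auto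
      then show ?thesis using c by (simp add: field_simps)
    qed
    then have "inverse c * (INF q\<in>C. q (c *\<^sub>R x)) \<le> (INF q\<in>C. q x)"
      by (intro cINF_greatest assms)
    then show "(INF q\<in>C. q (c *\<^sub>R x)) \<le> c * (INF q\<in>C. q x)"
      using c by (simp add: field_simps)
  qed
  show "(\<lambda>x. INF q\<in>C. q x) \<le> q" if "q \<in> C" for q
    using le[OF that] by (rule le_funI)
qed

text \<open>A pair \<open>(k, t)\<close> in \<open>K\<close> encodes the demand
  \<open>t \<le> f k\<close> on a linear \<open>f\<close>. Passing from \<open>p\<close> to
  \<open>q\<close> builds these demands into the majorant: \<open>f \<le> q\<close> forces
  \<open>f (- k) \<le> p 0 - t = - t\<close>. The infimum is finite because
  \<open>t \<le> p k \<le> p (x + k) + p (- x)\<close>.\<close>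

lemma sublinear_cone_INF:
  fixes K :: "('a::real_vector \<times> real) set"
  assumes p: "sublinear p" and K: "convex_cone K" and le: "\<And>k t. (k, t) \<in> K \<Longrightarrow> t \<le> p k"
  defines "q \<equiv> \<lambda>x. INF (k, t)\<in>K. p (x + k) - t"
  shows "sublinear q" and "q \<le> p" and "\<And>k t x. (k, t) \<in> K \<Longrightarrow> q x \<le> p (x + k) - t"
proof -
  have ne: "K \<noteq> {}" and add: "\<And>u v. u \<in> K \<Longrightarrow> v \<in> K \<Longrightarrow> u + v \<in> K"
    and scale: "\<And>u c. u \<in> K \<Longrightarrow> 0 \<le> c \<Longrightarrow> c *\<^sub>R u \<in> K"
    using K convex_cone_nonempty[OF K] by (auto simp: convex_cone_iff)
  have "- p (- x) \<le> p (x + k) - t" if "(k, t) \<in> K" for x k t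
    using sublinear_add[OF p, of "x + k" "- x"] le[OF that] by simp
  then have bdd: "bdd_below ((\<lambda>(k, t). p (x + k) - t) ` K)" for x
    by (intro bdd_belowI2[where m = "- p (- x)"]) auto
  show q_le: "q x \<le> p (x + k) - t" if "(k, t) \<in> K" for k t x
    unfolding q_def using cINF_lower[OF bdd that, of x] by simp
  have q_ge: "a \<le> q x" if "\<And>k t. (k, t) \<in> K \<Longrightarrow> a \<le> p (x + k) - t" for a x
    unfolding q_def using that by (intro cINF_greatest ne) auto
  have "(0, 0) \<in> K" using ne scale[of _ 0] by (fastforce simp: zero_prod_def)
  then show "q \<le> p" using q_le[of 0 0] by (intro le_funI) simp
  show "sublinear q"
  proof (rule sublinearI)
    fix x y
    have *: "q (x + y) \<le> (p (x + k) - t) + (p (y + l) - s)" if "(k, t) \<in> K" "(l, s) \<in> K" for k t l s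
    proof -
      have "q (x + y) \<le> p ((x + y) + (k + l)) - (t + s)"
        using add[OF that] by (intro q_le) simp
      also have "p ((x + y) + (k + l)) \<le> p (x + k) + p (y + l)"
        using sublinear_add[OF p, of "x + k" "y + l"] by (simp add: algebra_simps)
      finally show ?thesis by simp
    qed
    have "q (x + y) - (p (y + l) - s) \<le> q x" if "(l, s) \<in> K" for l s
      using *[OF _ that] by (intro q_ge) (simp add: algebra_simps)
    then have "q (x + y) - q x \<le> q y"
      by (intro q_ge) (simp add: algebra_simps)
    then show "q (x + y) \<le> q x + q y" by simp
  next
    fix c :: real and x assume c: "0 < c"
    have "inverse c * q (c *\<^sub>R x) \<le> p (x + k) - t" if "(k, t) \<in> K" for k t
    proof -
      have "q (c *\<^sub>R x) \<le> p (c *\<^sub>R x + c *\<^sub>R k) - c * t"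
        using scale[OF that, of c] c by (intro q_le) simp
      also have "p (c *\<^sub>R x + c *\<^sub>R k) = c * p (x + k)"
        using sublinear_scaleR[OF p, of c "x + k"] c by (simp add: algebra_simps)
      finally show ?thesis using c by (simp add: field_simps)
    qed
    then have "inverse c * q (c *\<^sub>R x) \<le> q x" by (rule q_ge)
    then show "q (c *\<^sub>R x) \<le> c * q x" using c by (simp add: field_simps)
  qed
qed

section \<open>Minimal sublinear functionals and Hahn-Banach\<close>

text \<open>Lowering \<open>q\<close> along the ray through \<open>(y, q y)\<close> yields a
  sublinear functional below \<open>q\<close>, hence \<open>q\<close> itself by minimality; the
  bound that comes with the pair \<open>(y, q y)\<close> is then superadditivity.\<close>

lemma minimal_sublinear_linear:
  assumes q: "sublinear q" and min: "\<And>r. sublinear r \<Longrightarrow> r \<le> q \<Longrightarrow> r = q"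
  shows "linear q"
proof -
  have add: "q (x + y) = q x + q y" for x y
  proof (rule antisym)
    define K where "K = {(t *\<^sub>R y, t * q y) | t. 0 \<le> t}"
    have K: "convex_cone K"
      unfolding convex_cone_iff
    proof (intro conjI ballI allI impI)
      show "0 \<in> K" unfolding K_def by (auto simp: zero_prod_def intro!: exI[of _ 0])
    next
      fix u v assume "u \<in> K" "v \<in> K"
      then obtain s t where "0 \<le> s" "0 \<le> t" "u = (s *\<^sub>R y, s * q y)" "v = (t *\<^sub>R y, t * q y)"
        unfolding K_def by auto
      then show "u + v \<in> K"
        unfolding K_def by (auto simp: algebra_simps intro!: exI[of _ "s + t"])
    next
      fix u and c :: real assume "u \<in> K" "0 \<le> c"
      then obtain t where "0 \<le> t" "u = (t *\<^sub>R y, t * q y)"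
        unfolding K_def by auto
      with \<open>0 \<le> c\<close> show "c *\<^sub>R u \<in> K"
        unfolding K_def by (auto intro!: exI[of _ "c * t"])
    qed
    have K_le: "t \<le> q k" if "(k, t) \<in> K" for k t
      using that sublinear_scaleR[OF q] unfolding K_def by auto
    note r = sublinear_cone_INF[OF q K K_le]
    have "(y, q y) \<in> K" unfolding K_def by (auto intro!: exI[of _ 1])
    then have "q x \<le> q (x + y) - q y"
      using r(3)[of y "q y" x] min[OF r(1,2)] by metis
    then show "q x + q y \<le> q (x + y)" by simp
  qed (rule sublinear_add[OF q])
  have minus: "q (- x) = - q x" for x
    using add[of x "- x"] sublinear_0[OF q] by simp
  have "q (c *\<^sub>R x) = c * q x" for c x
  proof (cases "0 \<le> c")
    case False
    then have "q ((- c) *\<^sub>R x) = - c * q x" by (intro sublinear_scaleR q) simp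
    then show ?thesis using minus[of "c *\<^sub>R x"] by simp
  qed (rule sublinear_scaleR[OF q])
  with add show ?thesis by (intro linearI) simp_all
qed

lemma sublinear_ge_linear:
  assumes p: "sublinear p"
  shows "\<exists>f. linear f \<and> f \<le> p"
proof -
  define A where "A = {q. sublinear q \<and> q \<le> p}"
  have "\<exists>m\<in>A. \<forall>a\<in>A. a \<le> m \<longrightarrow> a = m"
  \<comment> \<open>The order is reversed, so that a maximal element in Zorn's lemma is a minimal
    sublinear functional.\<close>
  proof (rule predicate_Zorn[where P = "\<lambda>q r. r \<le> q"])
    show "partial_order_on A (relation_of (\<lambda>q r. r \<le> q) A)"
      by (rule partial_order_on_relation_ofI) auto
  next
    fix C assume "C \<in> Chains (relation_of (\<lambda>q r. r \<le> q) A)"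
    then have C: "\<And>q. q \<in> C \<Longrightarrow> sublinear q \<and> q \<le> p"
      "\<And>q r. q \<in> C \<Longrightarrow> r \<in> C \<Longrightarrow> q \<le> r \<or> r \<le> q"
      unfolding Chains_def relation_of_def A_def by auto
    show "\<exists>u\<in>A. \<forall>a\<in>C. u \<le> a"
    \<comment> \<open>The infimum of an empty set of reals carries no information, so the empty
      chain is bounded by \<open>p\<close> instead.\<close>
    proof (cases "C = {}")
      case True
      then show ?thesis using p by (auto simp: A_def)
    next
      case False
      note m = sublinear_chain_INF[OF False C(1) p C(2)]
      obtain q where "q \<in> C" using False by blast
      then have "(\<lambda>x. INF q\<in>C. q x) \<le> p" using m(2) C(1) by (meson order_trans)
      with m show ?thesis unfolding A_def by blast
    qed
  qed
  then obtain m where m: "m \<in> A" "\<And>a. a \<in> A \<Longrightarrow> a \<le> m \<Longrightarrow> a = m" by blast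
  have "linear m"
    using m unfolding A_def by (intro minimal_sublinear_linear) (auto intro: order_trans)
  then show ?thesis using m(1) unfolding A_def by blast
qed

text \<open>The Mazur--Orlicz form of the Hahn--Banach theorem; encoding the lower bounds as a convex cone
  in the product with the reals covers both extension and separation.\<close>

theorem Hahn_Banach_cone:
  fixes K :: "('a::real_vector \<times> real) set"
  assumes p: "sublinear p" and K: "convex_cone K" and le: "\<And>k t. (k, t) \<in> K \<Longrightarrow> t \<le> p k"
  obtains f where "linear f" "f \<le> p" "\<And>k t. (k, t) \<in> K \<Longrightarrow> t \<le> f k"
proof -
  define q where "q x = (INF (k, t)\<in>K. p (x + k) - t)" for x
  have q: "sublinear q" "q \<le> p" "\<And>k t x. (k, t) \<in> K \<Longrightarrow> q x \<le> p (x + k) - t"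
    using sublinear_cone_INF[OF p K le] unfolding q_def by blast+
  obtain f where f: "linear f" "f \<le> q"
    using sublinear_ge_linear[OF q(1)] by blast
  have "t \<le> f k" if "(k, t) \<in> K" for k t
    using le_funD[OF f(2), of "- k"] q(3)[OF that, of "- k"] linear_neg[OF f(1), of k]
      sublinear_0[OF p] by simp
  moreover have "f \<le> p" using f(2) q(2) by (rule order_trans)
  ultimately show thesis using f(1) that by blast
qed

section \<open>Separation of a point from a closed convex set\<close>

text \<open>Some ball of radius \<open>d\<close> around \<open>a\<close> misses \<open>C\<close>, so
  the cone generated by the pairs \<open>(c - a, d)\<close> respects the bound
  \<open>t \<le> norm k\<close>. The Hahn-Banach functional for \<open>norm\<close> and this cone is
  continuous and satisfies \<open>d \<le> f (c - a)\<close>.\<close>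

theorem closed_convex_separation:
  fixes C :: "'a::real_normed_vector set"
  assumes "closed C" "convex C" "a \<notin> C"
  obtains f :: "'a \<Rightarrow>\<^sub>L real" and d where "0 < d" "\<And>c. c \<in> C \<Longrightarrow> blinfun_apply f a + d \<le> blinfun_apply f c"
proof (cases "C = {}")
  case True
  then show thesis using that[of 1 0] by simp
next
  case False
  obtain d where d: "0 < d" "ball a d \<subseteq> - C"
    using assms by (metis Compl_iff openE open_Compl)
  then have d_le: "d \<le> norm (c - a)" if "c \<in> C" for c
    using that by (force simp: dist_norm norm_minus_commute)
  define K where "K = {(t *\<^sub>R (c - a), t * d) | t c. 0 \<le> t \<and> c \<in> C}"
  have K: "convex_cone K"
    unfolding convex_cone_iff
  proof (intro conjI ballI allI impI)
    show "0 \<in> K" using False unfolding K_def by (force simp: zero_prod_def)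
  next
    fix u v assume "u \<in> K" "v \<in> K"
    then obtain s b t c where st: "0 \<le> s" "0 \<le> t" "b \<in> C" "c \<in> C"
      "u = (s *\<^sub>R (b - a), s * d)" "v = (t *\<^sub>R (c - a), t * d)"
      unfolding K_def by auto
    show "u + v \<in> K"
    proof (cases "s + t = 0")
      case True
      with st have "s = 0" "t = 0" by auto
      with st show ?thesis unfolding K_def by fastforce
    next
      case False
      \<comment> \<open>Convexity enters here: \<open>e\<close> merges the two weighted points into
        one point of \<open>C\<close> with weight \<open>s + t\<close>, which must be nonzero for
        the division.\<close>
      define e where "e = (s / (s + t)) *\<^sub>R b + (t / (s + t)) *\<^sub>R c"
      have "e \<in> C"
        unfolding e_def using st False by (intro convexD assms) (auto simp: add_divide_distrib[symmetric])
      moreover have "(s + t) *\<^sub>R e = s *\<^sub>R b + t *\<^sub>R c"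
        unfolding e_def scaleR_add_right using False by simp
      then have "u + v = ((s + t) *\<^sub>R (e - a), (s + t) * d)"
        using st by (simp add: algebra_simps)
      ultimately show ?thesis using st unfolding K_def by fastforce
    qed
  next
    fix u and c :: real assume "u \<in> K" "0 \<le> c"
    then obtain t b where "0 \<le> t" "b \<in> C" "u = (t *\<^sub>R (b - a), t * d)"
      unfolding K_def by auto
    with \<open>0 \<le> c\<close> show "c *\<^sub>R u \<in> K"
      unfolding K_def by (auto intro!: exI[of _ "c * t"] exI[of _ b])
  qed
  have norm: "sublinear (norm :: 'a \<Rightarrow> real)"
    by (rule sublinearI) (auto intro: norm_triangle_ineq)
  have le: "t \<le> norm k" if "(k, t) \<in> K" for k t
    using that by (auto simp: K_def d_le intro!: mult_left_mono)
  obtain f where f: "linear f" "f \<le> norm" "\<And>k t. (k, t) \<in> K \<Longrightarrow> t \<le> f k"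
    using Hahn_Banach_cone[OF norm K le] by metis
  \<comment> \<open>Domination by \<open>norm\<close> at both \<open>x\<close> and
    \<open>- x\<close> bounds the absolute value, so \<open>f\<close> is bounded with constant
    1.\<close>
  have "\<bar>f x\<bar> \<le> norm x" for x
    using le_funD[OF f(2), of x] le_funD[OF f(2), of "- x"] linear_neg[OF f(1), of x] by simp
  then have "bounded_linear f"
    using f(1) by (intro bounded_linear.intro) (auto simp: bounded_linear_axioms_def intro!: exI[of _ 1])
  then have Blinfun_f: "blinfun_apply (Blinfun f) = f" by (rule bounded_linear_Blinfun_apply)
  have "f a + d \<le> f c" if "c \<in> C" for c
  proof -
    have "(c - a, d) \<in> K" unfolding K_def using that by (auto intro!: exI[of _ 1])
    then show ?thesis using f(3) linear_diff[OF f(1), of c a] by fastforce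
  qed
  then show thesis using that[of d "Blinfun f"] d(1) by (simp add: Blinfun_f)
qed

text \<open>Singletons are closed and convex, so separation applies to distinct points; this is
  injectivity of the bidual embedding.\<close>

lemma blinfun_real_separates:
  assumes "\<And>f :: 'a::real_normed_vector \<Rightarrow>\<^sub>L real. blinfun_apply f x = blinfun_apply f y"
  shows "x = y"
proof (rule ccontr)
  assume "x \<noteq> y"
  then obtain f :: "'a \<Rightarrow>\<^sub>L real" and d where "0 < d" "blinfun_apply f x + d \<le> blinfun_apply f y"
    by (rule closed_convex_separation[of "{y}" x, simplified]) auto
  then show False using assms[of f] by simp
qed

section \<open>The weak topology\<close>

lemma openin_weak_topology_vimage:
  fixes f :: "'a::real_normed_vector \<Rightarrow>\<^sub>L real"
  shows "open U \<Longrightarrow> openin weak_topology (blinfun_apply f -` U)"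
  unfolding weak_topology_def by (rule topology_generated_by_Basis) blast

lemma topspace_weak_topology [simp]: "topspace weak_topology = UNIV"
  using openin_subset[OF openin_weak_topology_vimage[of UNIV 0]] by auto

text \<open>A separating functional yields the open half-space \<open>f < f a + d\<close>, a weak
  neighbourhood of \<open>a\<close> that misses \<open>C\<close>.\<close>

lemma closedin_weak_topology_convex:
  fixes C :: "'a::real_normed_vector set"
  assumes "closed C" "convex C"
  shows "closedin weak_topology C"
proof -
  have "\<exists>T. openin weak_topology T \<and> a \<in> T \<and> T \<subseteq> - C" if "a \<notin> C" for a
  proof -
    obtain f :: "'a \<Rightarrow>\<^sub>L real" and d where f: "0 < d" "\<And>c. c \<in> C \<Longrightarrow> blinfun_apply f a + d \<le> blinfun_apply f c"
      by (rule closed_convex_separation[OF assms \<open>a \<notin> C\<close>]) blast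
    have "openin weak_topology (blinfun_apply f -` {..<blinfun_apply f a + d})"
      by (rule openin_weak_topology_vimage) simp
    then show ?thesis using f by (force intro!: exI)
  qed
  then have "openin weak_topology (- C)"
    by (subst openin_subopen) blast
  then show ?thesis by (simp add: closedin_def Compl_eq_Diff_UNIV)
qed

text \<open>Banach--Alaoglu: the closed ball of the bidual is pointwise compact by Tychonoff's theorem, and
  in a reflexive space the inverse of the bidual embedding is pointwise-to-weakly continuous.\<close>

lemma compactin_weak_topology_reflexive:
  fixes Q :: "'a::real_normed_vector set"
  assumes "reflexive_Banach TYPE('a)" "bounded Q" "closedin weak_topology Q"
  shows "compactin weak_topology Q"
proof -
  \<comment> \<open>\<open>P\<close> carries the pointwise topology on all real functions on the
    dual. The box \<open>B\<close> of compact intervals is compact in it, and linearity is imposed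
    by the closed equations of \<open>L\<close>.\<close>
  define P where "P = product_topology (\<lambda>f :: 'a \<Rightarrow>\<^sub>L real. euclideanreal) UNIV"
  have proj: "continuous_map P euclideanreal (\<lambda>\<phi>. \<phi> f)" for f
    unfolding P_def by (rule continuous_map_product_projection) simp
  obtain R where R: "0 \<le> R" "\<And>x. x \<in> Q \<Longrightarrow> norm x \<le> R"
    using assms(2) by (metis bounded_pos less_imp_le)
  define B where "B = (\<Pi>\<^sub>E f\<in>UNIV :: ('a \<Rightarrow>\<^sub>L real) set. {- (R * norm f) .. R * norm f})"
  define L where "L = (\<Inter>f g. {\<phi> \<in> topspace P. \<phi> (f + g) = \<phi> f + \<phi> g}) \<inter>
     (\<Inter>c f. {\<phi> \<in> topspace P. \<phi> (c *\<^sub>R f) = c * \<phi> f})"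
  have "closedin P L"
    unfolding L_def
    by (intro closedin_Int closedin_INT closedin_continuous_maps_eq[OF Hausdorff_space_euclidean]
        continuous_map_add continuous_map_real_mult proj) auto
  moreover have "compactin P B"
    unfolding P_def B_def by (simp add: compactin_PiE)
  ultimately have BL: "compactin P (B \<inter> L)"
    by (metis compact_Int_closedin inf_commute)
  \<comment> \<open>By reflexivity every point of \<open>B \<inter> L\<close>, being linear and
    bounded by \<open>R\<close>, is evaluation at some \<open>x\<close>; outside this set the value
    of \<open>r\<close> is arbitrary.\<close>
  define r where "r \<phi> = (SOME x. \<forall>f. blinfun_apply f x = \<phi> f)" for \<phi> :: "('a \<Rightarrow>\<^sub>L real) \<Rightarrow> real"
  have r: "blinfun_apply f (r \<phi>) = \<phi> f" if \<phi>: "\<phi> \<in> B \<inter> L" for f \<phi>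
  proof -
    have "bounded_linear \<phi>"
    proof (rule bounded_linear_intro[of _ R])
      fix f g c show "\<phi> (f + g) = \<phi> f + \<phi> g" "\<phi> (c *\<^sub>R f) = c *\<^sub>R \<phi> f"
        using \<phi> by (auto simp: L_def)
      have "\<phi> f \<in> {- (R * norm f) .. R * norm f}" using \<phi> unfolding B_def by blast
      then show "norm (\<phi> f) \<le> norm f * R" by (auto simp: abs_le_iff mult.commute)
    qed
    then have "blinfun_apply (Blinfun \<phi>) = \<phi>" by (rule bounded_linear_Blinfun_apply)
    moreover obtain x where "bidual_embedding x = Blinfun \<phi>"
      using assms(1) unfolding reflexive_Banach_def by (metis surjD)
    ultimately have "\<forall>f. blinfun_apply f x = \<phi> f"
      by (metis bidual_embedding_apply)
    then have "\<forall>f. blinfun_apply f (r \<phi>) = \<phi> f"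
      unfolding r_def by (rule someI)
    then show ?thesis by blast
  qed
  have "continuous_map (subtopology P (B \<inter> L)) weak_topology r"
    unfolding weak_topology_def
  proof (rule continuous_on_generated_topo)
    fix W assume "W \<in> {blinfun_apply f -` U | (f :: 'a \<Rightarrow>\<^sub>L real) U. open U}"
    then obtain f :: "'a \<Rightarrow>\<^sub>L real" and U where W: "W = blinfun_apply f -` U" "open U" by blast
    \<comment> \<open>Continuity is checked on the generating sets only; their preimages under
      \<open>r\<close> restrict the single coordinate \<open>\<phi> f\<close>.\<close>
    have "r -` W \<inter> topspace (subtopology P (B \<inter> L)) =
      {\<phi> \<in> topspace (subtopology P (B \<inter> L)). \<phi> f \<in> U}"
      using r W by auto
    moreover have "openin (subtopology P (B \<inter> L)) {\<phi> \<in> topspace (subtopology P (B \<inter> L)). \<phi> f \<in> U}"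
      using W by (intro openin_continuous_map_preimage[where Y = euclideanreal]
          continuous_map_from_subtopology proj) simp
    ultimately show "openin (subtopology P (B \<inter> L)) (r -` W \<inter> topspace (subtopology P (B \<inter> L)))"
      by simp
  qed (use topspace_weak_topology in \<open>auto simp: weak_topology_def\<close>)
  then have "compactin weak_topology (r ` (B \<inter> L))"
    using BL by (intro image_compactin[where X = "subtopology P (B \<inter> L)"]) (simp_all add: compactin_subtopology)
  moreover have "Q \<subseteq> r ` (B \<inter> L)"
  proof
    fix x assume "x \<in> Q"
    \<comment> \<open>Evaluation at \<open>x\<close> lies in \<open>B\<close> because
      \<open>R\<close> bounds \<open>Q\<close>, and \<open>r\<close> sends it back to
      \<open>x\<close> because functionals separate points.\<close>
    define \<phi> where "\<phi> f = blinfun_apply f x" for f :: "'a \<Rightarrow>\<^sub>L real"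
    have "\<bar>\<phi> f\<bar> \<le> R * norm f" for f
    proof -
      have "\<bar>\<phi> f\<bar> \<le> norm f * norm x"
        unfolding \<phi>_def using norm_blinfun[of f x] by simp
      also have "\<dots> \<le> R * norm f"
        using R(2)[OF \<open>x \<in> Q\<close>] by (simp add: mult.commute mult_right_mono)
      finally show ?thesis .
    qed
    then have "\<phi> \<in> B" unfolding B_def by (auto simp: abs_le_iff PiE_UNIV_domain) (smt (verit))
    moreover have "\<phi> \<in> L"
      unfolding L_def \<phi>_def P_def by (simp add: blinfun.add_left blinfun.scaleR_left)
    ultimately have "\<phi> \<in> B \<inter> L" by simp
    moreover have "r \<phi> = x"
      by (rule blinfun_real_separates) (simp add: r[OF \<open>\<phi> \<in> B \<inter> L\<close>] \<phi>_def)
    ultimately show "x \<in> r ` (B \<inter> L)" by blast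
  qed
  ultimately show ?thesis using assms(3) by (rule closed_compactin)
qed

section \<open>Zeros of the minimal time function\<close>

text \<open>Convexity and \<open>0 \<in> F\<close> make the sets \<open>tF\<close> grow with
  \<open>t\<close>, so a hit at a time \<open>s < t\<close> persists at \<open>t\<close>. Only
  positive times occur on the right, since the infimum 0 need not be attained.\<close>

lemma minimal_time_eq_0_iff:
  assumes "convex F" "0 \<in> F"
  shows "minimal_time F Q x = 0 \<longleftrightarrow> (\<forall>t>0. (+) x ` ((*\<^sub>R) t ` F) \<inter> Q \<noteq> {})"
proof
  assume L: "minimal_time F Q x = 0"
  show "\<forall>t>0. (+) x ` ((*\<^sub>R) t ` F) \<inter> Q \<noteq> {}"
  proof (intro allI impI)
    fix t :: real assume t: "0 < t"
    then have "minimal_time F Q x < ennreal t" using L by simp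
    then obtain s where "0 \<le> s" "ennreal s < ennreal t" "(+) x ` ((*\<^sub>R) s ` F) \<inter> Q \<noteq> {}"
      unfolding minimal_time_def Inf_less_iff by blast
    then have s: "0 \<le> s" "s < t" "(+) x ` ((*\<^sub>R) s ` F) \<inter> Q \<noteq> {}"
      by (simp_all add: ennreal_less_iff)
    have "(*\<^sub>R) s ` F \<subseteq> (*\<^sub>R) t ` F"
    proof clarify
      fix f assume "f \<in> F"
      have "(s / t) *\<^sub>R f + (1 - s / t) *\<^sub>R 0 \<in> F"
        using assms \<open>f \<in> F\<close> s t by (intro convexD) auto
      then have "t *\<^sub>R (s / t) *\<^sub>R f \<in> (*\<^sub>R) t ` F" by (intro imageI) simp
      then show "s *\<^sub>R f \<in> (*\<^sub>R) t ` F" using t by simp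
    qed
    with s show "(+) x ` ((*\<^sub>R) t ` F) \<inter> Q \<noteq> {}" by blast
  qed
next
  assume R: "\<forall>t>0. (+) x ` ((*\<^sub>R) t ` F) \<inter> Q \<noteq> {}"
  \<comment> \<open>Every positive time is a hit and so bounds the infimum; the summand
    \<open>0\<close> fits the form of \<open>ennreal_le_epsilon\<close>.\<close>
  have "minimal_time F Q x \<le> 0 + ennreal e" if "0 < e" for e
    unfolding minimal_time_def using R that by (auto intro!: Inf_lower)
  then have "minimal_time F Q x \<le> 0"
    by (rule ennreal_le_epsilon)
  then show "minimal_time F Q x = 0" by simp
qed

text \<open>The topology \<open>T\<close> is left open to cover the norm and the weak topology at
  once. The sets \<open>S t\<close> are closed and convex, hence closed in \<open>T\<close>, and the
  finite intersection property in \<open>Q\<close> gives a common point \<open>q\<close>; then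
  \<open>q - x\<close> is the required direction.\<close>

lemma compactin_minimal_time_eq_0:
  fixes F Q :: "'a::real_normed_vector set"
  assumes F: "closed F" "convex F" "0 \<in> F" and Q: "compactin T Q"
    and T: "\<And>C :: 'a set. closed C \<Longrightarrow> convex C \<Longrightarrow> closedin T C"
  shows "minimal_time F Q x = 0 \<longleftrightarrow> x \<in> {q - d | q d. q \<in> Q \<and> d \<in> asymptotic_cone F}"
proof -
  define S where "S t = (+) x ` ((*\<^sub>R) t ` F)" for t :: real
  have S_iff: "y \<in> S t \<longleftrightarrow> inverse t *\<^sub>R (y - x) \<in> F" if "0 < t" for y t
    using that unfolding S_def image_image by (force simp: image_iff)
  have clo: "closedin T (S t)" for t
    unfolding S_def using F
    by (intro T closed_translation closed_scaling convex_translation convex_scaling)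
  have cone: "d \<in> asymptotic_cone F \<longleftrightarrow> (\<forall>t>0. x + d \<in> S t)" for d
  proof -
    have "d \<in> asymptotic_cone F \<longleftrightarrow> (\<forall>t>0. t *\<^sub>R d \<in> F)"
      using asymptotic_cone_eq[OF F] by simp
    \<comment> \<open>Inversion permutes the positive reals; it turns the large multiples of
      \<open>d\<close> that define the cone into the small times \<open>t\<close> of
      \<open>S t\<close>.\<close>
    also have "\<dots> \<longleftrightarrow> (\<forall>t>0. inverse t *\<^sub>R d \<in> F)"
      by (metis inverse_inverse_eq inverse_positive_iff_positive)
    finally show ?thesis by (auto simp: S_iff)
  qed
  have "(\<forall>t>0. S t \<inter> Q \<noteq> {}) \<longleftrightarrow> (\<exists>q\<in>Q. \<forall>t>0. q \<in> S t)"
  proof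
    assume ne: "\<forall>t>0. S t \<inter> Q \<noteq> {}"
    have mono: "S s \<subseteq> S t" if "0 < s" "s \<le> t" for s t
    proof
      fix y assume "y \<in> S s"
      then have "inverse s *\<^sub>R (y - x) \<in> F" using S_iff that by blast
      then have "(s / t) *\<^sub>R (inverse s *\<^sub>R (y - x)) + (1 - s / t) *\<^sub>R 0 \<in> F"
        using F that by (intro convexD) auto
      moreover have "s / t * inverse s = inverse t" using that by (simp add: field_simps)
      ultimately show "y \<in> S t" using that by (simp add: S_iff)
    qed
    have "Q \<inter> \<Inter> (S ` {0<..}) \<noteq> {}"
    proof -
      have "Q \<inter> \<Inter> \<F> \<noteq> {}" if \<F>: "finite \<F>" "\<F> \<subseteq> S ` {0<..}" for \<F>
      proof -
        obtain A where A: "finite A" "A \<subseteq> {0<..}" "\<F> = S ` A"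
          using finite_subset_image[OF \<F>] by blast
        \<comment> \<open>As the sets are nested, the least parameter gives a subset of all members
          of the finite family; inserting 1 covers the empty family.\<close>
        define t where "t = Min (insert 1 A)"
        have "t \<in> insert 1 A"
          unfolding t_def using A by (intro Min_in) auto
        then have "0 < t" using A(2) by auto
        then have "S t \<subseteq> S u" if "u \<in> A" for u
          using that A(1) unfolding t_def by (intro mono) simp_all
        then show ?thesis using ne \<open>0 < t\<close> A(3) by blast
      qed
      then show ?thesis using Q clo unfolding compactin_fip by (metis (no_types, lifting) imageE)
    qed
    then show "\<exists>q\<in>Q. \<forall>t>0. q \<in> S t" by auto
  qed blast
  also have "\<dots> \<longleftrightarrow> (\<exists>q\<in>Q. q - x \<in> asymptotic_cone F)"
    by (simp add: cone)
  also have "\<dots> \<longleftrightarrow> x \<in> {q - d | q d. q \<in> Q \<and> d \<in> asymptotic_cone F}"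
  proof
    assume "\<exists>q\<in>Q. q - x \<in> asymptotic_cone F"
    then obtain q where "q \<in> Q" "q - x \<in> asymptotic_cone F" by blast
    moreover have "x = q - (q - x)" by simp
    ultimately show "x \<in> {q - d | q d. q \<in> Q \<and> d \<in> asymptotic_cone F}" by blast
  next
    assume "x \<in> {q - d | q d. q \<in> Q \<and> d \<in> asymptotic_cone F}"
    then obtain q d where "q \<in> Q" "d \<in> asymptotic_cone F" "x = q - d" by blast
    then show "\<exists>q\<in>Q. q - x \<in> asymptotic_cone F" by (intro bexI[of _ q]) auto
  qed
  finally show ?thesis
    using F by (simp add: minimal_time_eq_0_iff S_def)
qed

theorem theorem3p1:
  fixes F Q :: "'a::real_normed_vector set" and x :: 'a
  assumes "F \<noteq> {}" and "closed F" and "convex F" and "Q \<noteq> {}"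
    and "(reflexive_Banach TYPE('a) \<and> bounded Q \<and> closedin weak_topology Q \<and> 0 \<in> F)
       \<or> (compact Q \<and> 0 \<in> F)"
  shows "minimal_time F Q x = 0 \<longleftrightarrow> x \<in> {q - d | q d. q \<in> Q \<and> d \<in> asymptotic_cone F}"
  using assms(5)
proof (elim disjE conjE)
  assume "reflexive_Banach TYPE('a)" "bounded Q" "closedin weak_topology Q" "0 \<in> F"
  then show ?thesis
    using assms by (intro compactin_minimal_time_eq_0[where T = weak_topology]
        compactin_weak_topology_reflexive) (auto intro: closedin_weak_topology_convex)
next
  assume "compact Q" "0 \<in> F"
  then show ?thesis
    by (intro compactin_minimal_time_eq_0[where T = euclidean] assms) simp_all
qed

end
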